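(* Let $s\ge 2$ and $n_1\ge n_2>n_3>\cdots>n_s>3$ be integers (that is, $n_1\ge n_2$, $n_i>n_{i+1}$ for $2\le i\le s-1$, and $n_s>3$). Then $|X^*_{n_1,\ldots,n_s}|=2n_1+n_2+s-2$, and the minimum number of vertices of a 3-uniform bi-hypergraph with feasible set $\{n_1,n_2,\ldots,n_s\}$ is at most $2n_1+n_2+s-2$.
   Context: For a positive integer $n$, $[n]=\{1,2,\ldots,n\}$, and $[0]=\emptyset$. A bi-hypergraph $\mathcal{H}=(X,\mathcal{B})$ consists of a finite set $X$ of vertices and a family $\mathcal{B}$ of subsets of $X$, called bi-edges; it is 3-uniform if every bi-edge has exactly three elements. A proper $k$-coloring of $\mathcal{H}$ is a map from $X$ into a set of $k$ colors such that each bi-edge contains two vertices with a common color and also contains two vertices with distinct colors. A strict $k$-coloring is a proper $k$-coloring that uses all $k$ colors. The feasible set $\Phi(\mathcal{H})$ is the set of all $k$ such that $\mathcal{H}$ has a strict $k$-coloring. For integers $s\ge 2$ and $n_1\ge n_2>\cdots>n_s>3$, define the following sets of $s$-tuples. $X_1=\{(n_2+j,1,\ldots,1),\ (n_2+j,n_2,n_3,\ldots,n_s) : j\in[n_1-n_2]\}$. For $i=2,\ldots,s-1$, $$X_i=\bigcup_{j=1}^{n_i-n_{i+1}}\{(n_{i+1}+j,1,\ldots,1),\ (n_{i+1}+j,\ldots,n_{i+1}+j,n_{i+1},\ldots,n_s)\}\ \cup\ \bigcup_{j=0}^{n_i-n_{i+1}}\{(1,n_{i+1}+j,\ldots,n_{i+1}+j,1,\ldots,1)\},$$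 where in $(n_{i+1}+j,\ldots,n_{i+1}+j,n_{i+1},\ldots,n_s)$ the first $i$ coordinates equal $n_{i+1}+j$ and coordinates $i+1,\ldots,s$ are $n_{i+1},\ldots,n_s$, and in $(1,n_{i+1}+j,\ldots,n_{i+1}+j,1,\ldots,1)$ the value $n_{i+1}+j$ appears $i-1$ times (in coordinates $2,\ldots,i$). $$X_s=\bigcup_{i=1}^{3}\bigcup_{k=1}^{3}\{(i,k,\ldots,k)\}\ \cup\ \bigcup_{k=4}^{n_s}\{(1,k,\ldots,k),(k,1,\ldots,1),(k,\ldots,k)\}.$$ Let $X^*_{n_1,\ldots,n_s}=\bigcup_{i=1}^s X_i$. *)

theory Defs
  imports Main "HOL-Library.Extended_Nat"
begin

definition bi_hypergraph :: "'a set \<Rightarrow> 'a set set \<Rightarrow> bool" where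
  "bi_hypergraph X \<B> \<longleftrightarrow> finite X \<and> (\<forall>B\<in>\<B>. B \<subseteq> X)"

definition three_uniform :: "'a set set \<Rightarrow> bool" where
  "three_uniform \<B> \<longleftrightarrow> (\<forall>B\<in>\<B>. card B = 3)"

definition proper_coloring :: "'a set \<Rightarrow> 'a set set \<Rightarrow> nat \<Rightarrow> ('a \<Rightarrow> nat) \<Rightarrow> bool" where
  "proper_coloring X \<B> k c \<longleftrightarrow>
     c ` X \<subseteq> {1..k} \<and>
     (\<forall>B\<in>\<B>. (\<exists>x\<in>B. \<exists>y\<in>B. x \<noteq> y \<and> c x = c y) \<and> (\<exists>x\<in>B. \<exists>y\<in>B. c x \<noteq> c y))"

definition strict_coloring :: "'a set \<Rightarrow> 'a set set \<Rightarrow> nat \<Rightarrow> ('a \<Rightarrow> nat) \<Rightarrow> bool" where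
  "strict_coloring X \<B> k c \<longleftrightarrow> proper_coloring X \<B> k c \<and> c ` X = {1..k}"

definition feasible_set :: "'a set \<Rightarrow> 'a set set \<Rightarrow> nat set" where
  "feasible_set X \<B> = {k. \<exists>c. strict_coloring X \<B> k c}"

text \<open>Every finite hypergraph is isomorphic to one with vertices in \<open>nat\<close>, so restricting the
  vertex type loses nothing. The infimum is over a set of extended naturals: it is attained if
  a realization exists, and is \<open>\<infinity>\<close> otherwise, so a finite bound includes existence.\<close>

definition min_vertices :: "nat set \<Rightarrow> enat" where
  "min_vertices S = Inf {enat (card X) | (X :: nat set) \<B>.
     bi_hypergraph X \<B> \<and> three_uniform \<B> \<and> feasible_set X \<B> = S}"

text \<open>An \<open>s\<close>-tuple is a list of length \<open>s\<close>; the sequence \<open>n\<close> is indexed from 1, and only its values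
  at \<open>1, \<dots>, s\<close> matter.\<close>

definition X_first :: "nat \<Rightarrow> (nat \<Rightarrow> nat) \<Rightarrow> nat list set" where
  "X_first s n =
     (\<Union>j\<in>{1..n 1 - n 2}. {(n 2 + j) # replicate (s - 1) 1, (n 2 + j) # map n [2..<s + 1]})"

definition X_mid :: "nat \<Rightarrow> (nat \<Rightarrow> nat) \<Rightarrow> nat \<Rightarrow> nat list set" where
  "X_mid s n i =
     (\<Union>j\<in>{1..n i - n (i + 1)}.
        {(n (i + 1) + j) # replicate (s - 1) 1,
         replicate i (n (i + 1) + j) @ map n [i + 1..<s + 1]}) \<union>
     (\<Union>j\<in>{0..n i - n (i + 1)}.
        {1 # replicate (i - 1) (n (i + 1) + j) @ replicate (s - i) 1})"

definition X_last :: "nat \<Rightarrow> (nat \<Rightarrow> nat) \<Rightarrow> nat list set" where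
  "X_last s n =
     (\<Union>i\<in>{1..3}. \<Union>k\<in>{1..3}. {i # replicate (s - 1) k}) \<union>
     (\<Union>k\<in>{4..n s}. {1 # replicate (s - 1) k, k # replicate (s - 1) 1, replicate s k})"

definition X_star :: "nat \<Rightarrow> (nat \<Rightarrow> nat) \<Rightarrow> nat list set" where
  "X_star s n = X_first s n \<union> (\<Union>i\<in>{2..s - 1}. X_mid s n i) \<union> X_last s n"

end

theory Submission
  imports Defs "HOL-Library.Countable"
begin

text \<open>
  The hypergraph is the largest one on \<open>X_star s n\<close> that admits every coordinate as a coloring: its
  bi-edges are the triples on which each of the \<open>s\<close> coordinates takes exactly two values. The
  \<open>i\<close>-th coordinate takes exactly the values \<open>1, \<dots>, n i\<close> (\<open>nth_image\<close>), so every \<open>n i\<close> is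
  feasible. The point is that a proper coloring induces the same partition as some coordinate.

  Five kinds of vertices are present. Besides the points \<open>grid i k = (i, k, \<dots>, k)\<close> of a
  \<open>3 \<times> 3\<close> grid there are, for each level \<open>v\<close>, the vertex \<open>row v = (v, 1, \<dots>, 1)\<close>, the vertex
  \<open>diag v\<close> all of whose coordinates are \<open>v\<close>, cut off at the maximum \<open>n i\<close> of that coordinate, and
  the vertex \<open>col v\<close>, whose first coordinate is \<open>1\<close> and whose other coordinates are \<open>v\<close> where
  \<open>v \<le> n i\<close> and \<open>1\<close> elsewhere. Finally \<open>twin t\<close> differs from \<open>col t\<close> only in that the coordinate
  with maximum \<open>t\<close> has the value \<open>1\<close>. So in the first coordinate \<open>diag v\<close> goes with \<open>row v\<close>, and in
  the others, up to their maximum, with \<open>col v\<close>.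

  The bi-edges inside the grid force its coloring to be constant along rows or constant along
  columns (\<open>grid_coloring\<close>). A few bi-edges per level propagate this choice. In the
  first case the partition is that of the first coordinate (\<open>card_colors_rows\<close>). In the second case
  the twins decide: each \<open>twin t\<close> has either the color of \<open>diag t\<close> or that of \<open>(1, \<dots>, 1)\<close>, and
  for the least \<open>t = m\<close> with the latter color the partition is that of the coordinate with maximum
  \<open>m\<close> (\<open>card_colors_cols\<close>). Hence a strict coloring has \<open>n i\<close> colors for some \<open>i\<close>.
\<close>

section \<open>Triples with exactly two values\<close>

definition two_valued :: "'b \<Rightarrow> 'b \<Rightarrow> 'b \<Rightarrow> bool" where
  "two_valued a b c \<longleftrightarrow> (a = b \<or> a = c \<or> b = c) \<and> \<not> (a = b \<and> b = c)"

text \<open>When any three corners of a square carry exactly two colors, the four corners carry two colors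
  twice each: by rows, by columns or by diagonals.\<close>

lemma two_valued_square:
  assumes "two_valued a b c" "two_valued b a d" "two_valued c d a" "two_valued d c b"
  shows "a = b \<and> c = d \<and> a \<noteq> c \<or> a = c \<and> b = d \<and> a \<noteq> b \<or> a = d \<and> b = c \<and> a \<noteq> b"
  using assms unfolding two_valued_def by metis

text \<open>In a \<open>3 \<times> 3\<close> grid the nine squares cannot combine differently: two diagonal squares sharing
  a column make the third square in those two rows monochromatic along each row, and a square
  colored by rows leaves no colors for a diagonal one beside it once the third row is taken into
  account.\<close>

lemma grid_coloring:
  fixes d :: "nat \<Rightarrow> nat \<Rightarrow> 'b"
  assumes corner: "\<And>i k i' k'. \<lbrakk>i \<in> {1..3}; i' \<in> {1..3}; k \<in> {1..3}; k' \<in> {1..3}; i \<noteq> i'; k \<noteq> k'\<rbrakk>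
    \<Longrightarrow> two_valued (d i k) (d i k') (d i' k)"
  shows "(\<forall>i\<in>{1..3}. \<forall>k\<in>{1..3}. d i k = d i 1) \<and> inj_on (\<lambda>i. d i 1) {1..3} \<or>
         (\<forall>i\<in>{1..3}. \<forall>k\<in>{1..3}. d i k = d 1 k) \<and> inj_on (d 1) {1..3}"
proof -
  have three: "{1..3} = {1, 2, 3 :: nat}" by auto
  have sq: "d i k = d i k' \<and> d i' k = d i' k' \<and> d i k \<noteq> d i' k \<or>
            d i k = d i' k \<and> d i k' = d i' k' \<and> d i k \<noteq> d i k' \<or>
            d i k = d i' k' \<and> d i k' = d i' k \<and> d i k \<noteq> d i k'"
    if "i \<in> {1..3}" "i' \<in> {1..3}" "k \<in> {1..3}" "k' \<in> {1..3}" "i \<noteq> i'" "k \<noteq> k'" for i i' k k'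
    by (rule two_valued_square) (use that in \<open>auto intro!: corner\<close>)
  show ?thesis
    unfolding three inj_on_def
    using sq[of 1 2 1 2] sq[of 1 2 1 3] sq[of 1 2 2 3] sq[of 1 3 1 2] sq[of 1 3 1 3]
      sq[of 1 3 2 3] sq[of 2 3 1 2] sq[of 2 3 1 3] sq[of 2 3 2 3]
    by simp (smt (verit))
qed

section \<open>Transport of hypergraphs along injections\<close>

lemma feasible_set_image:
  assumes f: "inj_on f X" and B: "\<And>B. B \<in> \<B> \<Longrightarrow> B \<subseteq> X"
  shows "feasible_set (f ` X) ((`) f ` \<B>) = feasible_set X \<B>"
proof -
  have push: "strict_coloring (f ` X) ((`) f ` \<B>) k c \<longleftrightarrow> strict_coloring X \<B> k (c \<circ> f)" for k c
  proof -
    have "f x \<noteq> f y \<longleftrightarrow> x \<noteq> y" if "B \<in> \<B>" "x \<in> B" "y \<in> B" for B x y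
      using f B that by (meson inj_on_eq_iff subsetD)
    then show ?thesis
      unfolding strict_coloring_def proper_coloring_def by (simp add: image_comp)
  qed
  have "strict_coloring X \<B> k (c \<circ> inv_into X f \<circ> f) \<longleftrightarrow> strict_coloring X \<B> k c" for k c
  proof -
    have "(c \<circ> inv_into X f \<circ> f) x = c x" if "x \<in> X" for x
      using f that by simp
    then show ?thesis
      unfolding strict_coloring_def proper_coloring_def
      using B by (smt (verit, best) image_cong subsetD)
  qed
  then show ?thesis
    unfolding feasible_set_def push by (metis comp_assoc)
qed

lemma min_vertices_le:
  fixes X :: "'a::countable set"
  assumes "bi_hypergraph X \<B>" "three_uniform \<B>"
  shows "min_vertices (feasible_set X \<B>) \<le> enat (card X)"
proof -
  have inj: "inj_on to_nat A" for A :: "'a set"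
    by (simp add: inj_on_def)
  have "bi_hypergraph (to_nat ` X) ((`) to_nat ` \<B>)"
    using assms(1) unfolding bi_hypergraph_def by blast
  moreover have "three_uniform ((`) to_nat ` \<B>)"
    using assms(2) unfolding three_uniform_def by (simp add: card_image[OF inj])
  moreover have "feasible_set (to_nat ` X) ((`) to_nat ` \<B>) = feasible_set X \<B>"
    using assms(1) by (intro feasible_set_image inj) (auto simp: bi_hypergraph_def)
  moreover have "card (to_nat ` X) = card X"
    by (rule card_image[OF inj])
  ultimately show ?thesis
    unfolding min_vertices_def
    by (intro Inf_lower CollectI exI[of _ "to_nat ` X"] exI[of _ "(`) to_nat ` \<B>"]) simp
qed

section \<open>The vertices by levels\<close>

locale color_numbers =
  fixes s :: nat and n :: "nat \<Rightarrow> nat"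
  assumes s_ge: "s \<ge> 2"
    and n1_ge: "n 1 \<ge> n 2"
    and n_decr: "\<And>i. 2 \<le> i \<Longrightarrow> i \<le> s - 1 \<Longrightarrow> n i > n (i + 1)"
    and ns_gt: "n s > 3"
begin

text \<open>Since \<open>n\<close> is injective on \<open>{2..s}\<close>, the coordinates after the first can be named by their
  maxima, the elements of \<open>T\<close>. A vertex \<open>profile a f\<close> has first coordinate \<open>a\<close> and the value
  \<open>f m\<close> in the coordinate with maximum \<open>m\<close>. All vertices of \<open>X_star s n\<close> have this form with an
  \<open>f\<close> independent of \<open>s\<close> and \<open>n\<close>, so that a triple can be tested for all coordinates at
  once.\<close>

definition T :: "nat set" where
  "T = n ` {2..s}"

definition profile :: "nat \<Rightarrow> (nat \<Rightarrow> nat) \<Rightarrow> nat list" where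
  "profile a f = a # map (\<lambda>i. f (n i)) [2..<s + 1]"

definition diag :: "nat \<Rightarrow> nat list" where
  "diag v = profile v (\<lambda>m. min v m)"

definition row :: "nat \<Rightarrow> nat list" where
  "row v = profile v (\<lambda>m. 1)"

definition col :: "nat \<Rightarrow> nat list" where
  "col v = profile 1 (\<lambda>m. if v \<le> m then v else 1)"

definition twin :: "nat \<Rightarrow> nat list" where
  "twin t = profile 1 (\<lambda>m. if t < m then t else 1)"

definition grid :: "nat \<Rightarrow> nat \<Rightarrow> nat list" where
  "grid i k = profile i (\<lambda>m. k)"

lemma n_less: "2 \<le> i \<Longrightarrow> i < j \<Longrightarrow> j \<le> s \<Longrightarrow> n j < n i"
proof (induction j)
  case (Suc j)
  then show ?case
    using n_decr[of j] by (cases "i = j") (auto intro: less_trans[of _ "n j"])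
qed simp

lemma n_le: "2 \<le> i \<Longrightarrow> i \<le> j \<Longrightarrow> j \<le> s \<Longrightarrow> n j \<le> n i"
  using n_less[of i j] by (cases "i = j") auto

lemma inj_n: "inj_on n {2..s}"
  by (rule linorder_inj_onI) (use n_less in fastforce)+

lemma T_gt: "m \<in> T \<Longrightarrow> 3 < m"
  using n_le[of _ s] ns_gt unfolding T_def by fastforce

lemma n2_in: "n 2 \<in> T" and ns_in: "n s \<in> T" and finite_T: "finite T"
  using s_ge unfolding T_def by auto

lemma n2_gt: "3 < n 2"
  using T_gt n2_in by simp

lemma T_le: "m \<in> T \<Longrightarrow> m \<le> n 2" and T_ge: "m \<in> T \<Longrightarrow> n s \<le> m"
  using n_le[of 2] n_le[of _ s] unfolding T_def by auto

lemma profile_eq_iff: "profile a f = profile b g \<longleftrightarrow> a = b \<and> (\<forall>m\<in>T. f m = g m)"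
  unfolding profile_def T_def by (auto simp: Ball_def less_Suc_eq_le)

lemma profile_nth: "profile a f ! 0 = a" "j \<in> {1..<s} \<Longrightarrow> profile a f ! j = f (n (Suc j))"
  unfolding profile_def by (auto simp: nth_Cons' simp del: upt_Suc)

lemma profile_eq_consts:
  "a # replicate (s - 1) k = profile a (\<lambda>m. k)"
  using s_ge unfolding profile_def by (intro nth_equalityI) (auto simp: nth_Cons' simp del: upt_Suc)

text \<open>The first three levels of \<open>row\<close>, \<open>col\<close> and \<open>diag\<close> lie in the grid, because every maximum
  exceeds \<open>3\<close>; in this way the propagation from level to level starts in the grid.\<close>

lemma low_levels:
  assumes "v \<le> 3"
  shows "diag v = grid v v" "row v = grid v 1" "col v = grid 1 v"
  using assms T_gt unfolding diag_def row_def col_def grid_def profile_eq_iff by force+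

lemma X_first_eq: "X_first s n = row ` {n 2<..n 1} \<union> diag ` {n 2<..n 1}"
proof -
  have 1: "(n 2 + j) # replicate (s - 1) 1 = row (n 2 + j)" for j
    unfolding row_def profile_eq_consts ..
  have 2: "(n 2 + j) # map n [2..<s + 1] = diag (n 2 + j)" for j
    unfolding diag_def profile_def using n_le[of 2] by fastforce
  have 3: "(\<lambda>j. n 2 + j) ` {1..n 1 - n 2} = {n 2<..n 1}"
    using n1_ge by (auto simp: image_iff intro!: le_add_diff_inverse[symmetric] bexI)
  show ?thesis
    unfolding X_first_def 1 2 3[symmetric] by blast
qed

lemma X_mid_eq:
  assumes i: "2 \<le> i" "i \<le> s - 1"
  shows "X_mid s n i = row ` {n (i+1)<..n i} \<union> diag ` {n (i+1)<..n i} \<union> col ` {n (i+1)<..n i}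
           \<union> {twin (n (i+1))}"
proof -
  let ?m = "n (i + 1)"
  let ?J = "{1..n i - ?m}"
  have up: "n i \<le> n i'" if "2 \<le> i'" "i' \<le> i" for i'
    using n_le that i by simp
  have down: "n i' \<le> ?m" if "i < i'" "i' \<le> s" for i'
    using n_le that i by simp
  have less: "?m < n i"
    using n_decr i by simp
  have sum: "(\<lambda>j. ?m + j) ` ?J = {?m<..n i}"
    using less by (auto simp: image_iff intro!: le_add_diff_inverse[symmetric] bexI)
  have rows: "(?m + j) # replicate (s - 1) 1 = row (?m + j)" for j
    unfolding row_def profile_eq_consts ..
  have split: "[2..<s + 1] = [2..<i + 1] @ [i + 1..<s + 1]"
    using i upt_add_eq_append[of 2 "i + 1" "s - i"] by simp
  have const: "replicate (i - 1) v = map f [2..<i + 1]" if "\<And>i'. 2 \<le> i' \<Longrightarrow> i' \<le> i \<Longrightarrow> f i' = v"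
    for v :: nat and f
    using that i by (intro nth_equalityI) (auto simp del: upt_Suc)
  have const': "replicate (s - i) v = map f [i + 1..<s + 1]"
    if "\<And>i'. i < i' \<Longrightarrow> i' \<le> s \<Longrightarrow> f i' = v" for v :: nat and f
    using that i by (intro nth_equalityI) (auto simp del: upt_Suc)
  have diags: "replicate i (?m + j) @ map n [i + 1..<s + 1] = diag (?m + j)" if "j \<in> ?J" for j
  proof -
    have "replicate i (?m + j) = (?m + j) # replicate (i - 1) (?m + j)"
      using i by (cases i) auto
    moreover have "replicate (i - 1) (?m + j) = map (\<lambda>i. min (?m + j) (n i)) [2..<i + 1]"
      by (rule const) (use up that less in fastforce)
    moreover have "n i' = min (?m + j) (n i')" if "i' \<in> set [i + 1..<s + 1]" for i'
      using down[of i'] that by (auto simp del: upt_Suc)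
    then have "map n [i + 1..<s + 1] = map (\<lambda>i. min (?m + j) (n i)) [i + 1..<s + 1]"
      by (intro map_cong refl)
    ultimately show ?thesis
      unfolding diag_def profile_def split by simp
  qed
  have cols: "1 # replicate (i - 1) (?m + j) @ replicate (s - i) 1 = col (?m + j)"
    if "j \<in> ?J" for j
  proof -
    have "replicate (i - 1) (?m + j) =
        map (\<lambda>i. if ?m + j \<le> n i then ?m + j else 1) [2..<i + 1]"
      by (rule const) (use up that less in fastforce)
    moreover have "replicate (s - i) 1 =
        map (\<lambda>i. if ?m + j \<le> n i then ?m + j else 1) [i + 1..<s + 1]"
      by (rule const') (use down that in fastforce)
    ultimately show ?thesis
      unfolding col_def profile_def split by simp
  qed
  have twins: "1 # replicate (i - 1) ?m @ replicate (s - i) 1 = twin ?m"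
  proof -
    have "replicate (i - 1) ?m = map (\<lambda>i. if ?m < n i then ?m else 1) [2..<i + 1]"
      by (rule const) (use up less in fastforce)
    moreover have "replicate (s - i) 1 = map (\<lambda>i. if ?m < n i then ?m else 1) [i + 1..<s + 1]"
      by (rule const') (use down in fastforce)
    ultimately show ?thesis
      unfolding twin_def profile_def split by simp
  qed
  have "{0..n i - ?m} = insert 0 ?J" by auto
  then have "X_mid s n i = (\<Union>j\<in>?J. {row (?m + j), diag (?m + j)})
      \<union> insert (twin ?m) (\<Union>j\<in>?J. {col (?m + j)})"
    unfolding X_mid_def using rows diags cols twins by simp
  also have "\<dots> = row ` {?m<..n i} \<union> diag ` {?m<..n i} \<union> col ` {?m<..n i} \<union> {twin ?m}"
    unfolding sum[symmetric] by blast
  finally show ?thesis .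
qed

definition grid_set :: "nat list set" where
  "grid_set = (\<lambda>(i, k). grid i k) ` ({1..3} \<times> {1..3})"

lemma X_last_eq: "X_last s n = grid_set \<union> row ` {3<..n s} \<union> diag ` {3<..n s} \<union> col ` {3<..n s}"
proof -
  have 1: "replicate s k = diag k" if "k \<in> {4..n s}" for k
  proof -
    have "replicate s k = k # replicate (s - 1) k"
      using s_ge by (cases s) auto
    also have "\<dots> = diag k"
      unfolding profile_eq_consts diag_def profile_eq_iff using that T_ge by fastforce
    finally show ?thesis .
  qed
  have 2: "1 # replicate (s - 1) k = col k" if "k \<in> {4..n s}" for k
    unfolding profile_eq_consts col_def profile_eq_iff using that T_ge by fastforce
  have 3: "k # replicate (s - 1) 1 = row k" for k
    unfolding profile_eq_consts row_def ..
  have "(\<Union>i\<in>{1..3}. \<Union>k\<in>{1..3}. {i # replicate (s - 1) k}) = grid_set"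
    unfolding grid_set_def grid_def profile_eq_consts by auto
  moreover have "(\<Union>k\<in>{4..n s}. {1 # replicate (s - 1) k, k # replicate (s - 1) 1, replicate s k})
      = (\<Union>k\<in>{3<..n s}. {col k, row k, diag k})"
    using 1 2 3 by (intro SUP_cong) auto
  ultimately have "X_last s n = grid_set \<union> (\<Union>k\<in>{3<..n s}. {col k, row k, diag k})"
    unfolding X_last_def by (rule arg_cong2)
  then show ?thesis
    by blast
qed

lemma Un_levels: "(\<Union>i\<in>{2..s - 1}. {n (i+1)<..n i}) \<union> {3<..n s} = {3<..n 2}"
proof -
  have union: "(\<Union>i\<in>{2..<j}. {n (i+1)<..n i}) \<union> {3<..n j} = {3<..n 2}" if "2 \<le> j" "j \<le> s" for j
    using that
  proof (induction j rule: dec_induct)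
    case (step j)
    have "3 < n (j + 1)" "n (j + 1) \<le> n j"
      using step T_gt[of "n (j + 1)"] n_le[of j "j + 1"] unfolding T_def by auto
    then have levels: "{n (j+1)<..n j} \<union> {3<..n (j+1)} = {3<..n j}"
      by auto
    have "{2..<Suc j} = insert j {2..<j}"
      using step by auto
    then have "(\<Union>i\<in>{2..<Suc j}. {n (i+1)<..n i}) \<union> {3<..n (j+1)}
        = (\<Union>i\<in>{2..<j}. {n (i+1)<..n i}) \<union> ({n (j+1)<..n j} \<union> {3<..n (j+1)})"
      by (simp only: UN_insert Un_ac)
    then show ?case
      unfolding levels using step.IH step.prems by simp
  qed simp
  have "{2..<s} = {2..s - 1}" by auto
  then show ?thesis
    using union[of s] s_ge by simp
qed

text \<open>No twin is listed for \<open>n 2\<close>: it would be the grid point \<open>(1, \<dots>, 1)\<close>. Counting the five parts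
  gives \<open>9 + 2 * (n 1 - 3) + (n 2 - 3) + (s - 2)\<close>.\<close>

lemma X_star_eq: "X_star s n = grid_set \<union> row ` {3<..n 1} \<union> diag ` {3<..n 1} \<union> col ` {3<..n 2}
    \<union> twin ` (T - {n 2})"
proof -
  have T': "(\<lambda>i. n (i + 1)) ` {2..s - 1} = T - {n 2}"
  proof -
    have "(\<lambda>i. n (i + 1)) ` {2..s - 1} = n ` ((\<lambda>i. i + 1) ` {2..s - 1})"
      by (simp only: image_image)
    also have "(\<lambda>i. i + 1) ` {2..s - 1} = {2..s} - {2}"
      using s_ge by (auto simp: image_iff intro!: le_add_diff_inverse[symmetric] bexI)
    also have "n ` ({2..s} - {2}) = T - {n 2}"
      using inj_n s_ge unfolding T_def by (subst inj_on_image_set_diff) auto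
    finally show ?thesis .
  qed
  have N: "{n 2<..n 1} \<union> {3<..n 2} = {3<..n 1}"
    using n1_ge T_gt[OF n2_in] by auto
  have "(\<Union>i\<in>{2..s - 1}. X_mid s n i) = (\<Union>i\<in>{2..s - 1}. row ` {n (i+1)<..n i}
      \<union> diag ` {n (i+1)<..n i} \<union> col ` {n (i+1)<..n i} \<union> {twin (n (i+1))})"
    by (intro SUP_cong refl X_mid_eq) simp_all
  also have "\<dots> = row ` (\<Union>i\<in>{2..s - 1}. {n (i+1)<..n i}) \<union> diag ` (\<Union>i\<in>{2..s - 1}. {n (i+1)<..n i})
      \<union> col ` (\<Union>i\<in>{2..s - 1}. {n (i+1)<..n i}) \<union> twin ` ((\<lambda>i. n (i + 1)) ` {2..s - 1})"
    by (simp only: UN_Un_distrib image_UN image_image UNION_singleton_eq_range)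
  finally have "X_star s n = grid_set
      \<union> row ` ({n 2<..n 1} \<union> ((\<Union>i\<in>{2..s - 1}. {n (i+1)<..n i}) \<union> {3<..n s}))
      \<union> diag ` ({n 2<..n 1} \<union> ((\<Union>i\<in>{2..s - 1}. {n (i+1)<..n i}) \<union> {3<..n s}))
      \<union> col ` ((\<Union>i\<in>{2..s - 1}. {n (i+1)<..n i}) \<union> {3<..n s})
      \<union> twin ` ((\<lambda>i. n (i + 1)) ` {2..s - 1})"
    unfolding X_star_def X_first_eq X_last_eq image_Un by (simp only: Un_ac)
  then show ?thesis
    unfolding Un_levels N T' .
qed

text \<open>Comparing the first two coordinates is enough to tell apart all pairs of vertices met below,
  except \<open>col t\<close> and \<open>twin t\<close>.\<close>

lemma profile_eqD: "profile a f = profile b g \<Longrightarrow> a = b \<and> f (n 2) = g (n 2)"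
  using n2_in by (auto simp: profile_eq_iff)

lemma card_X_star: "card (X_star s n) = 2 * n 1 + n 2 + s - 2"
  and finite_X_star: "finite (X_star s n)"
proof -
  note defs = diag_def row_def col_def twin_def grid_def
  have lt: "t < n 2" if "t \<in> T - {n 2}" for t
    using T_le[of t] that by auto
  have inj: "inj_on row A" "inj_on diag A" for A
    unfolding inj_on_def defs by (auto dest!: profile_eqD)
  have inj_col: "inj_on col {3<..n 2}"
    unfolding inj_on_def defs by (auto dest!: profile_eqD)
  have inj_twin: "inj_on twin (T - {n 2})"
    unfolding inj_on_def defs by (auto dest!: profile_eqD lt[OF DiffI])
  have inj_grid: "inj_on (\<lambda>(i, k). grid i k) ({1..3} \<times> {1..3})"
    unfolding inj_on_def defs by (auto dest!: profile_eqD)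
  have "card T = s - 1"
    unfolding T_def by (simp add: card_image inj_n)
  then have "card (T - {n 2}) = s - 2"
    using n2_in finite_T by simp
  then have cards: "card (row ` {3<..n 1}) = n 1 - 3"
    "card (diag ` {3<..n 1}) = n 1 - 3" "card (col ` {3<..n 2}) = n 2 - 3"
    "card (twin ` (T - {n 2})) = s - 2"
    by (simp_all add: card_image inj inj_col inj_twin)
  have card_grid: "card grid_set = 9"
    unfolding grid_set_def card_image[OF inj_grid] by simp
  have fin: "finite grid_set"
    unfolding grid_set_def by simp
  have d1: "grid_set \<inter> row ` {3<..n 1} = {}"
    by (auto simp: defs grid_set_def dest!: profile_eqD)
  have d2: "(grid_set \<union> row ` {3<..n 1}) \<inter> diag ` {3<..n 1} = {}"
    using n2_gt by (auto simp: defs grid_set_def dest!: profile_eqD)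
  have d3: "(grid_set \<union> row ` {3<..n 1} \<union> diag ` {3<..n 1}) \<inter> col ` {3<..n 2} = {}"
    by (auto simp: defs grid_set_def dest!: profile_eqD)
  have d4: "(grid_set \<union> row ` {3<..n 1} \<union> diag ` {3<..n 1} \<union> col ` {3<..n 2})
      \<inter> twin ` (T - {n 2}) = {}"
  proof -
    have "twin t \<noteq> col v" if t: "t \<in> T - {n 2}" and v: "v \<le> n 2" for t v
    proof
      assume eq: "twin t = col v"
      then have "t = v"
        using lt[OF t] v unfolding defs by (auto dest!: profile_eqD)
      then show False
        using eq t T_gt[of t] unfolding defs profile_eq_iff by auto
    qed
    moreover have "twin t \<noteq> grid i k" if "t \<in> T - {n 2}" "k \<le> 3" for t i k
      using lt[OF that(1)] that T_gt[of t] unfolding defs by (auto dest!: profile_eqD)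
    moreover have "twin t \<noteq> row v" "twin t \<noteq> diag v" if "3 < v" for t v
      using that unfolding defs by (auto dest!: profile_eqD)
    ultimately show ?thesis
      unfolding grid_set_def by fastforce
  qed
  show "card (X_star s n) = 2 * n 1 + n 2 + s - 2"
    unfolding X_star_eq using d1 d2 d3 d4 fin finite_T s_ge n1_ge n2_gt
    by (simp add: card_Un_disjoint cards card_grid del: One_nat_def)
  show "finite (X_star s n)"
    unfolding X_star_eq using fin finite_T by simp
qed

section \<open>The hypergraph\<close>

definition edges :: "nat list set set" where
  "edges = {{a, b, c} | a b c. {a, b, c} \<subseteq> X_star s n \<and> distinct [a, b, c] \<and>
     (\<forall>j<s. two_valued (a ! j) (b ! j) (c ! j))}"

lemma edgeI:
  assumes "profile a f \<in> X_star s n" "profile b g \<in> X_star s n" "profile c h \<in> X_star s n"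
    and "profile a f \<noteq> profile b g" "profile a f \<noteq> profile c h" "profile b g \<noteq> profile c h"
    and "two_valued a b c" "\<And>m. m \<in> T \<Longrightarrow> two_valued (f m) (g m) (h m)"
  shows "{profile a f, profile b g, profile c h} \<in> edges"
proof -
  have "two_valued (profile a f ! j) (profile b g ! j) (profile c h ! j)" if "j < s" for j
  proof (cases "j = 0")
    case False
    then have "n (Suc j) \<in> T" "j \<in> {1..<s}"
      using that unfolding T_def by auto
    then show ?thesis
      using assms(8) by (simp add: profile_nth)
  qed (simp add: profile_nth assms(7))
  with assms(1-6) show ?thesis
    unfolding edges_def by (intro CollectI exI[of _ "profile a f"] exI[of _ "profile b g"] exI[of _ "profile c h"]) simp
qed

lemma twin_n2: "twin (n 2) = row 1"
  unfolding twin_def row_def profile_eq_iff by (auto dest: T_le)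

lemma vertices_in:
  shows grid_in: "i \<in> {1..3} \<Longrightarrow> k \<in> {1..3} \<Longrightarrow> grid i k \<in> X_star s n"
    and row_in: "1 \<le> v \<Longrightarrow> v \<le> n 1 \<Longrightarrow> row v \<in> X_star s n"
    and diag_in: "1 \<le> v \<Longrightarrow> v \<le> n 1 \<Longrightarrow> diag v \<in> X_star s n"
    and col_in: "1 \<le> v \<Longrightarrow> v \<le> n 2 \<Longrightarrow> col v \<in> X_star s n"
    and twin_in: "t \<in> T \<Longrightarrow> twin t \<in> X_star s n"
proof -
  show g: "grid i k \<in> X_star s n" if "i \<in> {1..3}" "k \<in> {1..3}" for i k
    using that unfolding X_star_eq grid_set_def by auto
  show "row v \<in> X_star s n" if "1 \<le> v" "v \<le> n 1"
    using that g[of v 1] low_levels(2)[of v] unfolding X_star_eq by (cases "v \<le> 3") auto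
  show "diag v \<in> X_star s n" if "1 \<le> v" "v \<le> n 1"
    using that g[of v v] low_levels(1)[of v] unfolding X_star_eq by (cases "v \<le> 3") auto
  show "col v \<in> X_star s n" if "1 \<le> v" "v \<le> n 2"
    using that g[of 1 v] low_levels(3)[of v] unfolding X_star_eq by (cases "v \<le> 3") auto
  show "twin t \<in> X_star s n" if "t \<in> T"
    using that g[of 1 1] twin_n2 low_levels(2)[of 1] unfolding X_star_eq by (cases "t = n 2") auto
qed

lemma edge_grid:
  assumes "i \<in> {1..3}" "i' \<in> {1..3}" "k \<in> {1..3}" "k' \<in> {1..3}" "i \<noteq> i'" "k \<noteq> k'"
  shows "{grid i k, grid i k', grid i' k} \<in> edges"
  using assms grid_in[of i k] grid_in[of i k'] grid_in[of i' k]
  unfolding grid_def by (intro edgeI) (auto simp: two_valued_def dest!: profile_eqD)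

lemma min_eq_1: "m \<in> T \<Longrightarrow> min v m = Suc 0 \<longleftrightarrow> v = 1" "m \<in> T \<Longrightarrow> Suc 0 = min v m \<longleftrightarrow> v = 1"
  using T_gt[of m] by auto

text \<open>The remaining bi-edges are the ones that propagate a coloring from the grid to the higher levels.
  The following three involve \<open>row v\<close> and \<open>diag v\<close>, which exist up to level \<open>n 1\<close>.\<close>

context
  fixes v
  assumes v: "3 < v" "v \<le> n 1"
begin

lemma edge_diag_row_row:
  assumes "1 \<le> w" "w < v"
  shows "{diag v, row v, row w} \<in> edges"
  using assms v n2_gt diag_in[of v] row_in[of v] row_in[of w]
  unfolding diag_def row_def by (intro edgeI) (auto simp: two_valued_def min_eq_1 dest!: profile_eqD dest: T_gt)

lemma edge_row_row_diag:
  assumes "2 \<le> w" "w < v"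
  shows "{row v, row w, diag w} \<in> edges"
  using assms v n2_gt diag_in[of w] row_in[of v] row_in[of w]
  unfolding diag_def row_def by (intro edgeI) (auto simp: two_valued_def min_eq_1 dest!: profile_eqD dest: T_gt)

lemma edge_diag_twin_col:
  assumes "t \<in> T" "t < v"
  shows "{diag v, twin t, col t} \<in> edges"
proof -
  have "twin t \<noteq> col t"
    using assms T_gt[of t] unfolding twin_def col_def profile_eq_iff by auto
  then show ?thesis
    using assms v T_gt[of t] T_le[of t] diag_in[of v] twin_in[of t] col_in[of t]
    unfolding diag_def twin_def col_def
    by (intro edgeI) (auto simp: two_valued_def dest!: profile_eqD dest: T_gt)
qed

end

text \<open>The next bi-edges place \<open>col v\<close>, which exists up to level \<open>n 2\<close>.\<close>

context
  fixes v
  assumes v: "3 < v" "v \<le> n 2"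
begin

lemma edge_diag_row_col: "{diag v, row v, col v} \<in> edges"
  using v n1_ge diag_in[of v] row_in[of v] col_in[of v]
  unfolding diag_def row_def col_def by (intro edgeI) (auto simp: two_valued_def dest!: profile_eqD dest: T_gt)

lemma edge_diag_col_one: "{diag v, col v, row 1} \<in> edges"
  using v n1_ge diag_in[of v] row_in[of 1] col_in[of v]
  unfolding diag_def row_def col_def by (intro edgeI) (auto simp: two_valued_def dest!: profile_eqD dest: T_gt)

lemma edge_col_diag_col:
  assumes "2 \<le> l" "l < v"
  shows "{col v, diag l, col l} \<in> edges"
  using assms v n1_ge diag_in[of l] col_in[of v] col_in[of l]
  unfolding diag_def col_def by (intro edgeI) (auto simp: two_valued_def dest!: profile_eqD dest: T_gt)

text \<open>In the coordinates with maximum at least \<open>v\<close> the values are \<open>v, v, t\<close>, and in the others they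
  are \<open>m, 1, 1\<close>. This needs that no maximum lies strictly between \<open>t\<close> and \<open>v\<close>: there the values
  would be \<open>m, 1, t\<close>.\<close>

lemma edge_diag_col_twin:
  assumes "t \<in> T" "t < v" and top: "\<And>m. m \<in> T \<Longrightarrow> m < v \<Longrightarrow> m \<le> t"
  shows "{diag v, col v, twin t} \<in> edges"
  using assms v n1_ge diag_in[of v] col_in[of v] twin_in[of t]
  unfolding diag_def col_def twin_def
  by (intro edgeI) (auto simp: two_valued_def not_le not_less dest!: profile_eqD dest: T_gt top)

text \<open>Below the smallest maximum there is no twin yet; there \<open>col 2\<close> and \<open>col 3\<close> can take its
  place.\<close>

lemma edge_diag_col_col:
  assumes "v \<le> n s" "2 \<le> l" "l < v"
  shows "{diag v, col v, col l} \<in> edges"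
  using assms v n1_ge T_ge[THEN order_trans[OF assms(1)]] diag_in[of v] col_in[of v] col_in[of l]
  unfolding diag_def col_def
  by (intro edgeI) (auto simp: two_valued_def dest!: profile_eqD dest: T_gt)

end

text \<open>The last group places the twins.\<close>

context
  fixes t
  assumes t: "t \<in> T" "t < n 2"
begin

lemma edge_twin_diag_row: "{twin t, diag t, row t} \<in> edges"
  using t n1_ge T_gt[of t] diag_in[of t] row_in[of t] twin_in[of t]
  unfolding diag_def row_def twin_def
  by (intro edgeI) (auto simp: two_valued_def dest!: profile_eqD dest: T_gt)

lemma edge_twin_diag_one: "{twin t, diag t, row 1} \<in> edges"
  using t n1_ge T_gt[of t] diag_in[of t] row_in[of 1] twin_in[of t]
  unfolding diag_def row_def twin_def
  by (intro edgeI) (auto simp: two_valued_def dest!: profile_eqD dest: T_gt)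

lemma edge_twin_col_diag:
  assumes "2 \<le> l" "l < t"
  shows "{twin t, col l, diag l} \<in> edges"
  using assms t n1_ge T_gt[of t] diag_in[of l] col_in[of l] twin_in[of t]
  unfolding diag_def col_def twin_def
  by (intro edgeI) (auto simp: two_valued_def dest!: profile_eqD dest: T_gt)

end

section \<open>Every proper coloring induces the partition of a coordinate\<close>

lemma two_valued_coloring:
  assumes "proper_coloring (X_star s n) edges k c" "{a, b, d} \<in> edges"
  shows "two_valued (c a) (c b) (c d)"
proof -
  have "(\<exists>x\<in>{a, b, d}. \<exists>y\<in>{a, b, d}. x \<noteq> y \<and> c x = c y) \<and>
    (\<exists>x\<in>{a, b, d}. \<exists>y\<in>{a, b, d}. c x \<noteq> c y)"
    using assms unfolding proper_coloring_def by blast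
  then show ?thesis
    unfolding two_valued_def by (simp, metis)
qed

lemma X_star_cases:
  assumes "x \<in> X_star s n"
  obtains (grid) i k where "x = grid i k" "i \<in> {1..3}" "k \<in> {1..3}"
    | (row) v where "x = row v" "3 < v" "v \<le> n 1"
    | (diag) v where "x = diag v" "3 < v" "v \<le> n 1"
    | (col) v where "x = col v" "3 < v" "v \<le> n 2"
    | (twin) t where "x = twin t" "t \<in> T" "t < n 2"
proof -
  from assms consider "x \<in> grid_set" | "x \<in> row ` {3<..n 1}" | "x \<in> diag ` {3<..n 1}"
    | "x \<in> col ` {3<..n 2}" | "x \<in> twin ` (T - {n 2})"
    unfolding X_star_eq by blast
  then show thesis
  proof cases
    case 5
    then show ?thesis using that(5) T_le by (auto simp: le_less)
  qed (use that in \<open>auto simp: grid_set_def\<close>)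
qed

text \<open>If the grid is colored by rows, then \<open>row 1\<close>, \<open>row 2\<close> and \<open>row 3\<close> have three colors. Each
  of them forms a bi-edge with \<open>diag v\<close> and \<open>row v\<close>; if these two had different colors, the three
  colors would be among those two. So \<open>diag v\<close> and \<open>row v\<close> agree, and their color is then missing
  on every lower \<open>row w\<close>. The vertices \<open>col v\<close> and \<open>twin t\<close> get the color of \<open>(1, \<dots>, 1)\<close>, and the
  colors are counted by \<open>row 1, \<dots>, row (n 1)\<close>.\<close>

lemma card_colors_rows:
  assumes proper: "proper_coloring (X_star s n) edges k c"
    and rows: "\<And>i k. i \<in> {1..3} \<Longrightarrow> k \<in> {1..3} \<Longrightarrow> c (grid i k) = c (grid i 1)"
    and inj: "inj_on (\<lambda>i. c (grid i 1)) {1..3}"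
  shows "card (c ` X_star s n) = n 1"
proof -
  note two = two_valued_coloring[OF proper]
  have inj3: "c (row i) \<noteq> c (row j)" if "i \<in> {1..3}" "j \<in> {1..3}" "i \<noteq> j" for i j
    using inj_onD[OF inj, of i j] that by (auto simp: low_levels)
  have diag_color: "c (diag v) = c (row v)" if v: "3 < v" "v \<le> n 1" for v
    using two[OF edge_diag_row_row[OF v, of 1]] two[OF edge_diag_row_row[OF v, of 2]]
      two[OF edge_diag_row_row[OF v, of 3]] inj3[of 1 2] inj3[of 1 3] inj3[of 2 3] v
    unfolding two_valued_def by simp metis
  have less: "c (row w) \<noteq> c (row v)" if "3 < v" "v \<le> n 1" "1 \<le> w" "w < v" for v w
    using two[OF edge_diag_row_row[of v w]] diag_color[of v] that unfolding two_valued_def by auto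
  have inj_row: "inj_on (\<lambda>v. c (row v)) {1..n 1}"
  proof (rule linorder_inj_onI)
    fix w v assume "w < v" "w \<in> {1..n 1}" "v \<in> {1..n 1}"
    then show "c (row w) \<noteq> c (row v)"
      using less[of v w] inj3[of w v] by (cases "v \<le> 3") auto
  qed auto
  have col_color: "c (col v) = c (row 1)" if v: "3 < v" "v \<le> n 2" for v
    using two[OF edge_diag_row_col[OF v]] two[OF edge_diag_col_one[OF v]] diag_color[of v]
      less[of v 1] v n1_ge unfolding two_valued_def by auto
  have twin_color: "c (twin t) = c (row 1)" if t: "t \<in> T" "t < n 2" for t
    using two[OF edge_twin_diag_row[OF t]] two[OF edge_twin_diag_one[OF t]] diag_color[of t]
      less[of t 1] T_gt[of t] t n1_ge unfolding two_valued_def by auto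
  have "c ` X_star s n = (\<lambda>v. c (row v)) ` {1..n 1}"
  proof
    show "(\<lambda>v. c (row v)) ` {1..n 1} \<subseteq> c ` X_star s n"
      using row_in by auto
    have "c x \<in> (\<lambda>v. c (row v)) ` {1..n 1}" if "x \<in> X_star s n" for x
      using that
    proof (cases x rule: X_star_cases)
      case (grid i k)
      then have "c x = c (row i)" "i \<in> {1..n 1}"
        using rows[of i k] n2_gt n1_ge by (auto simp: low_levels)
      then show ?thesis by blast
    qed (use diag_color col_color twin_color n2_gt n1_ge in auto)
    then show "c ` X_star s n \<subseteq> (\<lambda>v. c (row v)) ` {1..n 1}"
      by blast
  qed
  then show ?thesis
    by (simp only: card_image[OF inj_row] card_atLeastAtMost diff_Suc_1 flip: Suc_eq_plus1)
qed

text \<open>If the grid is colored by columns, the rows collapse: \<open>row v\<close> forms bi-edges with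
  \<open>row 2, diag 2\<close> and with \<open>row 3, diag 3\<close>, which leaves only the color of \<open>(1, \<dots>, 1)\<close>, the base
  color. Let \<open>m\<close> be the least maximum whose twin has the base color. Up to level \<open>m\<close>, the vertices
  \<open>diag v\<close> and \<open>col v\<close> share a color, new at that level. Above \<open>m\<close>, every \<open>diag v\<close> has the color of
  \<open>col m\<close> and every \<open>col v\<close> and \<open>twin t\<close> has the base color. This is the partition of the coordinate
  with maximum \<open>m\<close>, with colors counted by \<open>col 1, \<dots>, col m\<close>.\<close>

lemma card_colors_cols:
  assumes proper: "proper_coloring (X_star s n) edges k c"
    and cols: "\<And>i k. i \<in> {1..3} \<Longrightarrow> k \<in> {1..3} \<Longrightarrow> c (grid i k) = c (grid 1 k)"
    and inj: "inj_on (\<lambda>k. c (grid 1 k)) {1..3}"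
  shows "card (c ` X_star s n) \<in> T"
proof -
  note two = two_valued_coloring[OF proper]
  define base where "base = c (row 1)"
  have col_diag3: "c (diag i) = c (col i)" "c (row i) = base" if "i \<in> {1..3}" for i
    using that cols[of i i] cols[of i 1] by (auto simp: base_def low_levels)
  have col1: "c (col 1) = base"
    by (simp add: base_def low_levels)
  have inj3: "c (col i) \<noteq> c (col j)" if "i \<in> {1..3}" "j \<in> {1..3}" "i \<noteq> j" for i j
    using inj_onD[OF inj, of i j] that by (auto simp: low_levels)
  have row_color: "c (row v) = base" if "1 \<le> v" "v \<le> n 1" for v
  proof (cases "v \<le> 3")
    case False
    then have v: "3 < v" "v \<le> n 1" using that by auto
    show ?thesis
      using two[OF edge_row_row_diag[OF v, of 2]] two[OF edge_row_row_diag[OF v, of 3]] v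
        col_diag3[of 2] col_diag3[of 3] inj3[of 1 2] inj3[of 1 3] inj3[of 2 3] col1
      unfolding two_valued_def by auto
  qed (use that col_diag3 in auto)
  have diag_color: "c (diag v) \<noteq> base" if "2 \<le> v" "v \<le> n 1" for v
  proof (cases "v \<le> 3")
    case True
    then show ?thesis
      using col_diag3[of v] col1 inj3[of v 1] that by auto
  next
    case False
    then show ?thesis
      using two[OF edge_diag_row_row[of v 1]] row_color[of v] row_color[of 1] that unfolding two_valued_def by auto
  qed
  have col_color: "c (col v) = c (diag v) \<or> c (col v) = base" if v: "3 < v" "v \<le> n 2" for v
    using two[OF edge_diag_col_one[OF v]] diag_color[of v] v n1_ge
    unfolding two_valued_def base_def by auto
  have twin_color: "c (twin t) = c (diag t) \<or> c (twin t) = base" if t: "t \<in> T" "t < n 2" for t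
    using two[OF edge_twin_diag_row[OF t]] row_color[of t] diag_color[of t] T_gt[of t] t n1_ge
    unfolding two_valued_def by auto
  define m where "m = (LEAST t. t \<in> T \<and> c (twin t) = base)"
  \<comment> \<open>\<open>twin (n 2)\<close> is \<open>(1, \<dots>, 1)\<close> itself, so the least element exists.\<close>
  have "\<exists>t. t \<in> T \<and> c (twin t) = base"
    using n2_in twin_n2 base_def by auto
  then have m: "m \<in> T" "c (twin m) = base"
    unfolding m_def by (metis (mono_tags, lifting) LeastI)+
  have before: "c (twin t) \<noteq> base" if "t \<in> T" "t < m" for t
    using not_less_Least that unfolding m_def by blast
  have m_le: "m \<le> n 2" and m_gt: "3 < m"
    using m T_le T_gt by auto
  have upto: "c (diag v) = c (col v) \<and> (\<forall>l. 1 \<le> l \<and> l < v \<longrightarrow> c (col l) \<noteq> c (col v))"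
    if "1 \<le> v" "v \<le> m" for v
    using that
  proof (induction v rule: less_induct)
    case (less v)
    show ?case
    proof (cases "v \<le> 3")
      case True
      then show ?thesis
        using col_diag3(1)[of v] inj3 less.prems by auto
    next
      case False
      then have v: "3 < v" "v \<le> n 2"
        using less.prems m_le by auto
      have new: "c (col v) \<noteq> c (col l)" if "2 \<le> l" "l < v" for l
        using two[OF edge_col_diag_col[OF v that]] less.IH[of l] that less.prems
        unfolding two_valued_def by auto
      \<comment> \<open>It remains to exclude the base color. With it, \<open>diag v\<close> would get the color of each vertex that
        forms a bi-edge with \<open>diag v\<close> and \<open>col v\<close> and has another color than the base.\<close>
      have "c (col v) \<noteq> base"
      proof
        assume o: "c (col v) = base"
        show False
        proof (cases "v \<le> n s")
          case True
          then show False
            using two[OF edge_diag_col_col[OF v True, of 2]]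
              two[OF edge_diag_col_col[OF v True, of 3]]
              inj3[of 1 2] inj3[of 1 3] inj3[of 2 3] col1 o diag_color[of v] v n1_ge
            unfolding two_valued_def by auto
        next
          case False
          \<comment> \<open>The color of \<open>diag v\<close> would be that of \<open>twin t\<close>, which below \<open>m\<close> is that of \<open>col t\<close>;
            but these three form a bi-edge.\<close>
          define t where "t = Max {m \<in> T. m < v}"
          have fin: "finite {m \<in> T. m < v}" "{m \<in> T. m < v} \<noteq> {}"
            using finite_T ns_in False by auto
          have t: "t \<in> T" "t < v" and top: "\<And>m. m \<in> T \<Longrightarrow> m < v \<Longrightarrow> m \<le> t"
            using Max_in[OF fin] Max_ge[OF fin(1)] unfolding t_def by auto
          have "c (twin t) = c (col t)"
            using twin_color[of t] before[of t] less.IH[of t] T_gt[of t] t less.prems m_le by auto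
          moreover have "c (diag v) = c (twin t)"
            using two[OF edge_diag_col_twin[OF v t top]] o before[of t] diag_color[of v]
              t less.prems v n1_ge
            unfolding two_valued_def by auto
          ultimately show False
            using two[OF edge_diag_twin_col[of v t]] t v n1_ge unfolding two_valued_def by auto
        qed
      qed
      then show ?thesis
        using col_color[OF v] new col1 by (metis One_nat_def Suc_1 Suc_leI le_neq_implies_less)
    qed
  qed
  have inj_col: "inj_on (\<lambda>v. c (col v)) {1..m}"
    by (rule linorder_inj_onI) (use upto in auto)
  have after_diag: "c (diag v) = c (col m)" if v: "m < v" "v \<le> n 1" for v
    using two[OF edge_diag_twin_col[of v m]] m m_gt v diag_color[of v] inj_onD[OF inj_col, of 1 m] col1
    unfolding two_valued_def by auto
  have after_col: "c (col v) = base" if v: "m < v" "v \<le> n 2" for v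
    using two[OF edge_col_diag_col[of v m]] upto[of m] m_gt col_color[of v] after_diag[of v] v n1_ge
    unfolding two_valued_def by auto
  have after_twin: "c (twin t) = base" if t: "m < t" "t \<in> T" "t < n 2" for t
    using two[OF edge_twin_col_diag[of t m]] upto[of m] m_gt twin_color[of t] after_diag[of t] t n1_ge
    unfolding two_valued_def by auto
  have "c ` X_star s n = (\<lambda>v. c (col v)) ` {1..m}"
  proof
    show "(\<lambda>v. c (col v)) ` {1..m} \<subseteq> c ` X_star s n"
      using col_in m_le by auto
    have base_in: "base \<in> (\<lambda>v. c (col v)) ` {1..m}"
      using col1 m_gt by force
    have "c x \<in> (\<lambda>v. c (col v)) ` {1..m}" if "x \<in> X_star s n" for x
      using that
    proof (cases x rule: X_star_cases)
      case (grid i k)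
      then have "c x = c (col k)" "k \<in> {1..m}"
        using cols[of i k] m_gt by (auto simp: low_levels)
      then show ?thesis by blast
    next
      case (row v)
      then show ?thesis using base_in row_color by simp
    next
      case (diag v)
      then show ?thesis
        using upto[of v] after_diag[of v] m_gt by (cases "v \<le> m") auto
    next
      case (col v)
      then show ?thesis
        using after_col[of v] base_in by (cases "v \<le> m") auto
    next
      case (twin t)
      consider "t < m" | "t = m" | "m < t" by linarith
      then show ?thesis
      proof cases
        case 1
        then have "c x = c (col t)" "t \<in> {1..m}"
          using twin_color[of t] before[of t] \<open>t \<in> T\<close> T_gt[of t] upto[of t] m_le \<open>x = twin t\<close> by auto
        then show ?thesis by blast
      qed (use twin m after_twin base_in in auto)
    qed
    then show "c ` X_star s n \<subseteq> (\<lambda>v. c (col v)) ` {1..m}"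
      by blast
  qed
  then show ?thesis
    using m(1) by (simp only: card_image[OF inj_col] card_atLeastAtMost diff_Suc_1 flip: Suc_eq_plus1)
qed

section \<open>The feasible set\<close>

lemma nth_image:
  assumes "j < s"
  shows "(\<lambda>x. x ! j) ` X_star s n = {1..n (Suc j)}"
proof (cases "j = 0")
  case True
  have "(\<lambda>x. x ! 0) ` X_star s n \<subseteq> {1..n 1}"
  proof (intro image_subsetI)
    fix x assume "x \<in> X_star s n"
    then show "x ! 0 \<in> {1..n 1}"
      by (cases x rule: X_star_cases)
        (use n1_ge n2_gt in \<open>auto simp: grid_def row_def diag_def col_def twin_def profile_nth\<close>)
  qed
  moreover have "v \<in> (\<lambda>x. x ! 0) ` X_star s n" if "v \<in> {1..n 1}" for v
    using that row_in[of v] by (intro image_eqI[of _ _ "row v"]) (auto simp: row_def profile_nth)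
  ultimately show ?thesis
    using True by auto
next
  case False
  let ?m = "n (Suc j)"
  have m: "?m \<in> T" and j: "j \<in> {1..<s}"
    using False assms unfolding T_def by auto
  note m_gt = T_gt[OF m] and m_le = T_le[OF m] and nth = profile_nth(2)[OF j]
  have "(\<lambda>x. x ! j) ` X_star s n \<subseteq> {1..?m}"
  proof (intro image_subsetI)
    fix x assume "x \<in> X_star s n"
    then show "x ! j \<in> {1..?m}"
      by (cases x rule: X_star_cases)
        (use m_gt in \<open>auto simp: grid_def row_def diag_def col_def twin_def nth dest: T_gt\<close>)
  qed
  moreover have "v \<in> (\<lambda>x. x ! j) ` X_star s n" if "v \<in> {1..?m}" for v
    using that m_le col_in[of v] by (intro image_eqI[of _ _ "col v"]) (auto simp: col_def nth)
  ultimately show ?thesis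
    by auto
qed

lemma feasible_edges: "feasible_set (X_star s n) edges = n ` {1..s}"
proof
  show "feasible_set (X_star s n) edges \<subseteq> n ` {1..s}"
  proof
    fix k assume "k \<in> feasible_set (X_star s n) edges"
    then obtain c where proper: "proper_coloring (X_star s n) edges k c"
      and all: "c ` X_star s n = {1..k}"
      unfolding feasible_set_def strict_coloring_def by blast
    have "n 1 \<in> n ` {1..s}" "T \<subseteq> n ` {1..s}"
      using s_ge unfolding T_def by auto
    moreover have "card (c ` X_star s n) \<in> insert (n 1) T"
      using grid_coloring[of "\<lambda>i k. c (grid i k)"] two_valued_coloring[OF proper edge_grid]
        card_colors_rows[OF proper] card_colors_cols[OF proper]
      by blast
    ultimately show "k \<in> n ` {1..s}"
      unfolding all by auto
  qed
  show "n ` {1..s} \<subseteq> feasible_set (X_star s n) edges"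
  proof
    fix k assume "k \<in> n ` {1..s}"
    then obtain i where i: "i \<in> {1..s}" "k = n i" by blast
    let ?c = "\<lambda>x :: nat list. x ! (i - 1)"
    have image: "?c ` X_star s n = {1..k}"
    proof -
      have "i - 1 < s" "Suc (i - 1) = i"
        using i by auto
      then show ?thesis
        using nth_image[of "i - 1"] i(2) by simp
    qed
    have "(\<exists>x\<in>B. \<exists>y\<in>B. x \<noteq> y \<and> ?c x = ?c y) \<and> (\<exists>x\<in>B. \<exists>y\<in>B. ?c x \<noteq> ?c y)" if "B \<in> edges" for B
    proof -
      obtain a b d where B: "B = {a, b, d}" "distinct [a, b, d]"
        and "\<forall>j<s. two_valued (a ! j) (b ! j) (d ! j)"
        using \<open>B \<in> edges\<close> unfolding edges_def by blast
      then have "two_valued (?c a) (?c b) (?c d)"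
        using i by auto
      then show ?thesis
        using B unfolding two_valued_def by auto
    qed
    then show "k \<in> feasible_set (X_star s n) edges"
      using image unfolding feasible_set_def strict_coloring_def proper_coloring_def
      by (intro CollectI exI[of _ ?c]) auto
  qed
qed

lemma min_vertices_bound: "min_vertices (n ` {1..s}) \<le> enat (2 * n 1 + n 2 + s - 2)"
proof -
  have "bi_hypergraph (X_star s n) edges"
    unfolding bi_hypergraph_def edges_def using finite_X_star by blast
  moreover have "three_uniform edges"
    unfolding three_uniform_def edges_def by auto
  ultimately show ?thesis
    using min_vertices_le[of "X_star s n" edges] by (simp add: feasible_edges card_X_star)
qed

end

theorem mainTheorem4:
  fixes s :: nat and n :: "nat \<Rightarrow> nat"
  assumes "s \<ge> 2"
    and "n 1 \<ge> n 2"
    and "\<And>i. 2 \<le> i \<Longrightarrow> i \<le> s - 1 \<Longrightarrow> n i > n (i + 1)"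
    and "n s > 3"
  shows "card (X_star s n) = 2 * n 1 + n 2 + s - 2 \<and>
         min_vertices (n ` {1..s}) \<le> enat (2 * n 1 + n 2 + s - 2)"
proof -
  interpret color_numbers s n
    using assms by unfold_locales
  show ?thesis
    using card_X_star min_vertices_bound by simp
qed

end
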